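(* Let $\Phi=\{P_1,\ldots,P_N\}$ be a collection of orthogonal projections of $\mathbb{R}^M$ onto proper linear subspaces $L_1,\ldots,L_N$ of $\mathbb{R}^M$. The map $\mathcal{A}_\Phi$ is injective if and only if for every non-zero $x\in\mathbb{R}^M$ the vectors $P_1x,\ldots,P_Nx$ span an $M$-dimensional subspace of $\mathbb{R}^M$ (equivalently, the vectors $P_1x,\ldots,P_Nx$ form an $N$-element frame in $\mathbb{R}^M$).
   Context: $\langle\cdot,\cdot\rangle$ is the standard inner product on $\mathbb{R}^M$. For a collection $\Phi=\{P_1,\ldots,P_N\}$ of orthogonal projections of $\mathbb{R}^M$, the map $\mathcal{A}_\Phi\colon(\mathbb{R}^M\smallsetminus\{0\})/\pm1\to\mathbb{R}_{\geq0}^N$ is defined by $x\mapsto(\langle P_1x,P_1x\rangle,\ldots,\langle P_Nx,P_Nx\rangle)$, where $(\mathbb{R}^M\smallsetminus\{0\})/\pm1$ is the quotient identifying $x$ with $-x$. An $N$-element frame in $\mathbb{R}^M$ is a list of $N$ vectors (possibly with repetitions or zeros) that spans $\mathbb{R}^M$. *)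

theory Defs
  imports "HOL-Analysis.Analysis"
begin

definition orthogonal_projection_onto ::
    "(real ^ 'm \<Rightarrow> real ^ 'm) \<Rightarrow> (real ^ 'm) set \<Rightarrow> bool" where
  "orthogonal_projection_onto P L \<longleftrightarrow>
     subspace L \<and> (\<forall>x. P x \<in> L \<and> x - P x \<in> orthogonal_comp L)"

definition pm_rel :: "((real ^ 'm) \<times> (real ^ 'm)) set" where
  "pm_rel = {(x, y). x \<noteq> 0 \<and> y \<noteq> 0 \<and> (y = x \<or> y = - x)}"

definition nonzero_mod_pm :: "(real ^ 'm) set set" where
  "nonzero_mod_pm = (UNIV - {0}) // pm_rel"

text \<open>The map on classes, via the common value of the formula on all representatives;
  see \<open>intensity_map_class\<close> below for independence of the representative.\<close>

definition intensity_map ::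
    "('n \<Rightarrow> real ^ 'm \<Rightarrow> real ^ 'm) \<Rightarrow> (real ^ 'm) set \<Rightarrow> real ^ 'n" where
  "intensity_map P X = the_elem ((\<lambda>x. \<chi> i. P i x \<bullet> P i x) ` X)"

text \<open>A family indexed by \<open>'n\<close> is a list of \<open>CARD('n)\<close> vectors, so repetitions and
  zeros are allowed.\<close>

definition is_frame :: "('n::finite \<Rightarrow> real ^ 'm) \<Rightarrow> bool" where
  "is_frame v \<longleftrightarrow> span (range v) = UNIV"

lemma equiv_pm_rel: "equiv (UNIV - {0}) pm_rel"
  by (rule equivI) (auto simp: pm_rel_def refl_on_def sym_def trans_def)

lemma orthogonal_projection_onto_eqI:
  assumes "orthogonal_projection_onto P L" "p \<in> L" "x - p \<in> orthogonal_comp L"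
  shows "P x = p"
proof -
  have L: "subspace L" and Px: "P x \<in> L" "x - P x \<in> orthogonal_comp L"
    using assms(1) by (auto simp: orthogonal_projection_onto_def)
  have "P x - p \<in> L"
    using L Px(1) assms(2) by (rule subspace_diff)
  moreover have "(x - p) - (x - P x) \<in> orthogonal_comp L"
    using subspace_orthogonal_comp assms(3) Px(2) by (rule subspace_diff)
  ultimately have "(P x - p) \<bullet> (P x - p) = 0"
    by (simp add: orthogonal_comp_def orthogonal_def)
  then show ?thesis by simp
qed

lemma orthogonal_projection_onto_minus:
  assumes "orthogonal_projection_onto P L"
  shows "P (- x) = - P x"
proof (rule orthogonal_projection_onto_eqI[OF assms])
  have L: "subspace L" and Px: "P x \<in> L" "x - P x \<in> orthogonal_comp L"
    using assms by (auto simp: orthogonal_projection_onto_def)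
  show "- P x \<in> L"
    using L Px(1) by (rule subspace_neg)
  show "- x - - P x \<in> orthogonal_comp L"
    using subspace_neg[OF subspace_orthogonal_comp Px(2)] by simp
qed

lemma intensity_map_class:
  assumes "\<And>i. orthogonal_projection_onto (P i) (L i)" "x \<noteq> 0"
  shows "intensity_map P (pm_rel `` {x}) = (\<chi> i. P i x \<bullet> P i x)"
proof -
  have "pm_rel `` {x} = {x, - x}"
    using assms(2) by (auto simp: pm_rel_def)
  then show ?thesis
    by (simp add: intensity_map_def orthogonal_projection_onto_minus[OF assms(1)])
qed

end

theory Submission
  imports Defs
begin

text \<open>
  For an orthogonal projection the difference of squared lengths factorises like a difference of
  squares, \<open>\<parallel>P u\<parallel>\<^sup>2 - \<parallel>P v\<parallel>\<^sup>2 = \<langle>P (u + v), u - v\<rangle>\<close> (lemma \<open>norm_projection_diff\<close>). Hence \<open>u\<close> and \<open>v\<close>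
  have the same intensities exactly when \<open>y = u - v\<close> is orthogonal to all the vectors \<open>P\<^sub>i x\<close>,
  where \<open>x = u + v\<close>; and \<open>u = \<plusminus>v\<close> means that \<open>x = 0\<close> or \<open>y = 0\<close>. A failure of injectivity is
  therefore, in the coordinates \<open>x\<close>, \<open>y\<close>, a pair of non-zero vectors with \<open>y\<close> orthogonal to the
  span of the \<open>P\<^sub>i x\<close>, that is, a non-zero \<open>x\<close> for which this span is not the whole space.

  One point needs care in passing from \<open>(x, y)\<close> back to \<open>(u, v)\<close>: the vectors \<open>x + y\<close> and
  \<open>x - y\<close> must be non-zero in order to represent classes. As \<open>y\<close> may be rescaled, it can be
  given a length different from that of \<open>x\<close>, which excludes \<open>y = \<plusminus>x\<close>.
\<close>

lemma linear_orthogonal_projection_onto: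
  fixes P :: "real ^ 'm \<Rightarrow> real ^ 'm"
  assumes P: "orthogonal_projection_onto P L"
  shows "linear P"
proof (rule linearI)
  note D = P[unfolded orthogonal_projection_onto_def]
  fix x y :: "real ^ 'm" and c :: real
  have "(x - P x) + (y - P y) \<in> orthogonal_comp L"
    using D by (intro subspace_add subspace_orthogonal_comp) auto
  then show "P (x + y) = P x + P y"
    using D by (intro orthogonal_projection_onto_eqI[OF P] subspace_add)
      (auto simp: algebra_simps)
  have "c *\<^sub>R (x - P x) \<in> orthogonal_comp L"
    using D by (intro subspace_scale subspace_orthogonal_comp) auto
  then show "P (c *\<^sub>R x) = c *\<^sub>R P x"
    using D by (intro orthogonal_projection_onto_eqI[OF P] subspace_scale)
      (auto simp: algebra_simps)
qed

lemma inner_orthogonal_projection: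
  assumes "orthogonal_projection_onto P L"
  shows "P x \<bullet> P y = P x \<bullet> y"
proof -
  have "P x \<bullet> (y - P y) = 0"
    using assms by (simp add: orthogonal_projection_onto_def orthogonal_comp_def orthogonal_def)
  then show ?thesis
    by (simp add: inner_diff_right)
qed

text \<open>
  By linearity \<open>\<langle>P (u + v), P (u - v)\<rangle>\<close> expands to the left-hand side, and the second \<open>P\<close> may be
  dropped because \<open>P\<close> changes a vector only by something orthogonal to its range.
\<close>

lemma norm_projection_diff:
  assumes "orthogonal_projection_onto P L"
  shows "P u \<bullet> P u - P v \<bullet> P v = P (u + v) \<bullet> (u - v)"
proof -
  note lin = linear_orthogonal_projection_onto[OF assms]
  have "P (u + v) \<bullet> (u - v) = P (u + v) \<bullet> P (u - v)"
    by (rule inner_orthogonal_projection[OF assms, symmetric])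
  also have "\<dots> = P u \<bullet> P u - P v \<bullet> P v"
    by (simp add: linear_add[OF lin] linear_diff[OF lin] inner_commute algebra_simps)
  finally show ?thesis by simp
qed

lemma inj_on_intensity_map_iff:
  fixes P :: "'n::finite \<Rightarrow> real ^ 'm \<Rightarrow> real ^ 'm"
  assumes P: "\<And>i. orthogonal_projection_onto (P i) (L i)"
  shows "inj_on (intensity_map P) nonzero_mod_pm \<longleftrightarrow>
    (\<forall>u v. u \<noteq> 0 \<longrightarrow> v \<noteq> 0 \<longrightarrow> (\<forall>i. P i u \<bullet> P i u = P i v \<bullet> P i v) \<longrightarrow> v = u \<or> v = - u)"
proof -
  have eq: "pm_rel `` {u} = pm_rel `` {v} \<longleftrightarrow> v = u \<or> v = - u"
    if "u \<noteq> 0" "v \<noteq> 0" for u v :: "real ^ 'm"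
    using eq_equiv_class_iff[OF equiv_pm_rel, of u v] that by (simp add: pm_rel_def)
  have "inj_on (intensity_map P) nonzero_mod_pm \<longleftrightarrow>
    (\<forall>u v. u \<noteq> 0 \<longrightarrow> v \<noteq> 0 \<longrightarrow>
      intensity_map P (pm_rel `` {u}) = intensity_map P (pm_rel `` {v}) \<longrightarrow>
      pm_rel `` {u} = pm_rel `` {v})"
    unfolding inj_on_def nonzero_mod_pm_def quotient_def by blast
  then show ?thesis
    by (simp add: intensity_map_class[of P L, OF P] eq vec_eq_iff cong: imp_cong)
qed

text \<open>
  The orthogonality criterion that the factorisation gives, in the coordinates \<open>x = u + v\<close> and
  \<open>y = u - v\<close>.
\<close>

lemma inj_on_intensity_map_iff_orthogonal:
  fixes P :: "'n::finite \<Rightarrow> real ^ 'm \<Rightarrow> real ^ 'm"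
  assumes P: "\<And>i. orthogonal_projection_onto (P i) (L i)"
  shows "inj_on (intensity_map P) nonzero_mod_pm \<longleftrightarrow>
    (\<forall>x y. x \<noteq> 0 \<longrightarrow> (\<forall>i. P i x \<bullet> y = 0) \<longrightarrow> y = 0)"
    (is "?inj \<longleftrightarrow> ?orth")
proof
  assume ?inj
  show ?orth
  proof (intro allI impI, rule ccontr)
    fix x y :: "real ^ 'm"
    assume x: "x \<noteq> 0" and orth: "\<forall>i. P i x \<bullet> y = 0" and y: "y \<noteq> 0"
    \<comment> \<open>Any length other than that of \<open>x\<close> keeps \<open>x + z\<close> and \<open>x - z\<close> away from zero.\<close>
    define z where "z = (2 * norm x / norm y) *\<^sub>R y"
    have norm_z: "norm z = 2 * norm x"
      using y by (simp add: z_def)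
    have ne: "x + z \<noteq> 0" "x - z \<noteq> 0"
      using norm_z x by (auto simp: add_eq_0_iff)
    have "P i (x + z) \<bullet> P i (x + z) = P i (x - z) \<bullet> P i (x - z)" for i
    proof -
      have "P i (x + z) \<bullet> P i (x + z) - P i (x - z) \<bullet> P i (x - z)
          = P i (2 *\<^sub>R x) \<bullet> (2 *\<^sub>R z)"
        by (simp add: norm_projection_diff[OF P] scaleR_2)
      also have "\<dots> = 0"
        using orth by (simp add: linear_scale[OF linear_orthogonal_projection_onto[OF P]] z_def)
      finally show ?thesis by simp
    qed
    then have "x - z = x + z \<or> x - z = - (x + z)"
      using \<open>?inj\<close> ne unfolding inj_on_intensity_map_iff[of P L, OF P] by blast
    then have "2 *\<^sub>R z = 0 \<or> 2 *\<^sub>R x = 0"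
      unfolding scaleR_2 by (auto simp: algebra_simps)
    then show False
      using x norm_z by auto
  qed
next
  assume ?orth
  show ?inj
    unfolding inj_on_intensity_map_iff[of P L, OF P]
  proof (intro allI impI)
    fix u v :: "real ^ 'm"
    assume "\<forall>i. P i u \<bullet> P i u = P i v \<bullet> P i v"
    then have "\<forall>i. P i (u + v) \<bullet> (u - v) = 0"
      by (simp flip: norm_projection_diff[OF P])
    then have "u + v = 0 \<or> u - v = 0"
      using \<open>?orth\<close> by blast
    then show "v = u \<or> v = - u"
      by (auto simp: add_eq_0_iff)
  qed
qed

lemma span_eq_UNIV_iff_orthogonal_trivial:
  fixes S :: "'a::euclidean_space set"
  shows "span S = UNIV \<longleftrightarrow> (\<forall>y. (\<forall>s\<in>S. s \<bullet> y = 0) \<longrightarrow> y = 0)"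
proof
  assume span: "span S = UNIV"
  show "\<forall>y. (\<forall>s\<in>S. s \<bullet> y = 0) \<longrightarrow> y = 0"
  proof (intro allI impI)
    fix y assume "\<forall>s\<in>S. s \<bullet> y = 0"
    then have "orthogonal y y"
      using span by (intro orthogonal_to_span[of y S]) (auto simp: orthogonal_def inner_commute)
    then show "y = 0"
      by (simp add: orthogonal_def)
  qed
next
  assume triv: "\<forall>y. (\<forall>s\<in>S. s \<bullet> y = 0) \<longrightarrow> y = 0"
  show "span S = UNIV"
  proof (rule ccontr)
    assume "span S \<noteq> UNIV"
    then obtain a where "a \<noteq> 0" "\<forall>s\<in>span S. a \<bullet> s = 0"
      using span_not_univ_subset_hyperplane[of S] by auto
    then show False
      using triv by (metis inner_commute span_base)
  qed
qed

lemma dim_span_eq_CARD_iff: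
  fixes S :: "(real ^ 'm) set"
  shows "dim (span S) = CARD('m) \<longleftrightarrow> span S = UNIV"
  using dim_eq_full[of S] by simp

theorem theorem1p1:
  fixes P :: "'n::finite \<Rightarrow> real ^ 'm \<Rightarrow> real ^ 'm"
    and L :: "'n \<Rightarrow> (real ^ 'm) set"
  assumes "\<And>i. orthogonal_projection_onto (P i) (L i)"
    and "\<And>i. L i \<noteq> UNIV"
  shows "(inj_on (intensity_map P) nonzero_mod_pm \<longleftrightarrow>
           (\<forall>x. x \<noteq> 0 \<longrightarrow> dim (span (range (\<lambda>i. P i x))) = CARD('m)))
       \<and> (\<forall>x. x \<noteq> 0 \<longrightarrow>
           (dim (span (range (\<lambda>i. P i x))) = CARD('m) \<longleftrightarrow> is_frame (\<lambda>i. P i x)))"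
  unfolding is_frame_def dim_span_eq_CARD_iff
    inj_on_intensity_map_iff_orthogonal[of P L, OF assms(1)]
    span_eq_UNIV_iff_orthogonal_trivial
  by auto

end
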